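(* The set of semimultiplicative functions $\mathbb{N}\to\mathbb{C}$ forms a commutative semigroup with identity under the binomial convolution $\circ$. Furthermore, if $F$ and $G$ are semimultiplicative and not identically zero, then $$a_{F\circ G}=a_Fa_G,\qquad c_{F\circ G}=c_Fc_G\frac{\xi(a_Fa_G)}{\xi(a_F)\xi(a_G)},$$ $$(F\circ G)'=\frac{\xi_{a_Fa_G}}{\xi(a_Fa_G)\,\xi}\left(\left(\frac{\xi(a_F)\,\xi}{\xi_{a_F}}F'\right)\circ\left(\frac{\xi(a_G)\,\xi}{\xi_{a_G}}G'\right)\right).$$
   Context: For $n\in\mathbb{N}$ write $n=\prod_p p^{\nu_p(n)}$; the binomial convolution is $(f\circ g)(n)=\sum_{d\mid n}\left(\prod_p\binom{\nu_p(n)}{\nu_p(d)}\right)f(d)g(n/d)$. $\xi(n)=\prod_p\nu_p(n)!$ and, for $a\in\mathbb{N}$, $\xi_a(n)=\xi(an)$. Products and quotients of functions are pointwise. A function $F:\mathbb{N}\to\mathbb{C}$ is semimultiplicative if $F(m)F(n)=F(\gcd(m,n))F(\mathrm{lcm}(m,n))$ for all $m,n\in\mathbb{N}$. A function is multiplicative if $f(1)=1$ and $f(mn)=f(m)f(n)$ whenever $\gcd(m,n)=1$. For a semimultiplicative $F$ not identically zero, $a_F$ denotes the smallest positive integer $k$ with $F(k)\ne0$, $c_F=F(a_F)$, and $F'$ is the multiplicative function with $F(n)=c_F F'(n/a_F)$ for all $n$ (with the convention $F'(x)=0$ if $x$ is not a positive integer); equivalently $F'(m)=F(a_Fm)/c_F$.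 Such a representation exists for every semimultiplicative $F$ not identically zero. *)

theory Defs
  imports Complex_Main "HOL-Computational_Algebra.Primes" "HOL-Algebra.Group"
begin

text \<open>
  An arithmetical function on the positive integers is represented by a function
  \<^typ>\<open>nat \<Rightarrow> complex\<close> whose value at \<open>0\<close> is \<open>0\<close>. This makes the representation unique,
  so that equality of arithmetical functions is equality in HOL. The condition is built into
  the predicates \<open>semimultiplicative\<close> and \<open>multiplicative\<close> below.
\<close>

definition semimultiplicative :: "(nat \<Rightarrow> complex) \<Rightarrow> bool" where
  "semimultiplicative F \<longleftrightarrow> F 0 = 0 \<and>
     (\<forall>m>0. \<forall>n>0. F m * F n = F (gcd m n) * F (lcm m n))"

definition multiplicative :: "(nat \<Rightarrow> complex) \<Rightarrow> bool" where
  "multiplicative f \<longleftrightarrow> f 0 = 0 \<and> f 1 = 1 \<and>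
     (\<forall>m>0. \<forall>n>0. coprime m n \<longrightarrow> f (m * n) = f m * f n)"

text \<open>
  In the next two definitions the product over all primes is restricted to the prime divisors
  of \<open>n\<close>; for \<open>n > 0\<close> and \<open>d dvd n\<close> every other factor is \<open>1\<close>.
\<close>

definition binom_conv :: "(nat \<Rightarrow> complex) \<Rightarrow> (nat \<Rightarrow> complex) \<Rightarrow> nat \<Rightarrow> complex"
  (infixl "\<circ>\<^sub>b" 70) where
  "(f \<circ>\<^sub>b g) n = (if n = 0 then 0 else
     \<Sum>d | d dvd n.
       of_nat (\<Prod>p\<in>prime_factors n. multiplicity p n choose multiplicity p d) * f d * g (n div d))"

definition xi :: "nat \<Rightarrow> complex" where
  "xi n = (\<Prod>p\<in>prime_factors n. fact (multiplicity p n))"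

definition xi_shift :: "nat \<Rightarrow> nat \<Rightarrow> complex" where
  "xi_shift a n = xi (a * n)"

definition semimult_monoid :: "(nat \<Rightarrow> complex) monoid" where
  "semimult_monoid =
     \<lparr>carrier = {F. semimultiplicative F}, mult = (\<circ>\<^sub>b), one = (\<lambda>n. if n = 1 then 1 else 0)\<rparr>"

text \<open>
  The parameters \<open>a\<^sub>F\<close>, \<open>c\<^sub>F\<close> and \<open>F'\<close>. They are meaningful only for a semimultiplicative
  \<open>F\<close> that is not identically zero.
\<close>

definition sm_a :: "(nat \<Rightarrow> complex) \<Rightarrow> nat" where
  "sm_a F = (LEAST k. k > 0 \<and> F k \<noteq> 0)"

definition sm_c :: "(nat \<Rightarrow> complex) \<Rightarrow> complex" where
  "sm_c F = F (sm_a F)"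

definition is_mult_part :: "(nat \<Rightarrow> complex) \<Rightarrow> (nat \<Rightarrow> complex) \<Rightarrow> bool" where
  "is_mult_part F f \<longleftrightarrow> multiplicative f \<and>
     (\<forall>n>0. F n = sm_c F * (if sm_a F dvd n then f (n div sm_a F) else 0))"

definition mult_part :: "(nat \<Rightarrow> complex) \<Rightarrow> nat \<Rightarrow> complex" where
  "mult_part F = (THE f. is_mult_part F f)"

text \<open>The description in \<open>mult_part\<close> is proper, and has the expected explicit form.\<close>

lemma
  assumes F: "semimultiplicative F" and nz: "\<exists>n>0. F n \<noteq> 0"
  shows is_mult_part_unique: "\<exists>!f. is_mult_part F f"
    and mult_part_eq: "mult_part F m = F (sm_a F * m) / sm_c F"
proof -
  define a where "a = sm_a F"
  have a: "a > 0 \<and> F a \<noteq> 0"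
    unfolding a_def sm_a_def using nz LeastI_ex[of "\<lambda>k. k > 0 \<and> F k \<noteq> 0"] by blast
  have least: "F k = 0" if "k > 0" "k < a" for k
    using not_less_Least[of k "\<lambda>k. k > 0 \<and> F k \<noteq> 0"] that unfolding a_def sm_a_def by blast
  have c: "sm_c F = F a" by (simp add: sm_c_def a_def)
  have sm: "F m * F n = F (gcd m n) * F (lcm m n)" if "m > 0" "n > 0" for m n
    using F that by (auto simp: semimultiplicative_def)
  have F0: "F 0 = 0" using F by (simp add: semimultiplicative_def)
  define f where "f = (\<lambda>m. F (a * m) / F a)"
  have van: "F n = 0" if "n > 0" "\<not> a dvd n" for n
  proof -
    have "gcd a n \<noteq> a" using that by (metis gcd_dvd2)
    moreover have "gcd a n \<le> a" using a by (simp add: gcd_le1_nat)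
    ultimately have "gcd a n < a" by simp
    then have "F (gcd a n) = 0" using least a by simp
    then show ?thesis using sm[of a n] a that by simp
  qed
  have mult: "F (a * (m * n)) / F a = F (a * m) / F a * (F (a * n) / F a)"
    if "m > 0" "n > 0" "coprime m n" for m n
  proof -
    have "gcd (a * m) (a * n) = a * gcd m n" by (simp add: gcd_mult_distrib_nat)
    then have gcd: "gcd (a * m) (a * n) = a" using that by simp
    have "a * lcm (a * m) (a * n) = a * (a * (m * n))"
      using prod_gcd_lcm_nat[of "a * m" "a * n"] unfolding gcd by (metis mult.assoc mult.left_commute)
    then have lcm: "lcm (a * m) (a * n) = a * (m * n)" using a by simp
    have "F (a * m) * F (a * n) = F a * F (a * (m * n))"
      using sm[of "a * m" "a * n"] a that unfolding gcd lcm by simp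
    then show ?thesis using a by (simp add: field_simps)
  qed
  have f: "is_mult_part F f"
    unfolding is_mult_part_def multiplicative_def c a_def[symmetric] f_def
    using a F0 van mult by simp
  have uniq: "g = f" if "is_mult_part F g" for g
  proof
    fix m
    show "g m = f m"
    proof (cases "m = 0")
      case True
      then show ?thesis using that F0 by (simp add: is_mult_part_def multiplicative_def f_def)
    next
      case False
      then have "a * m > 0" using a by simp
      then have "F (a * m) = F a * (if a dvd a * m then g (a * m div a) else 0)"
        using that unfolding is_mult_part_def c a_def[symmetric] by blast
      then have "F (a * m) = F a * g m" using a by simp
      then show ?thesis using a by (simp add: f_def)
    qed
  qed
  show "\<exists>!f. is_mult_part F f" using f uniq by blast
  have "mult_part F = f" unfolding mult_part_def using f uniq by (rule the_equality)
  then show "mult_part F m = F (sm_a F * m) / sm_c F" by (simp add: f_def c a_def[symmetric])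
qed

end

theory Submission
  imports Defs
begin

text \<open>
  The weight in the binomial convolution of \<open>F\<close> and \<open>G\<close> at \<open>d dvd n\<close> is
  \<open>xi n / (xi d * xi (n div d))\<close>, so dividing functions pointwise by \<open>xi\<close> turns the binomial
  convolution into the Dirichlet convolution; as \<open>xi\<close> satisfies the gcd-lcm identity and never
  vanishes, semimultiplicativity is not affected. A nonzero semimultiplicative function is a
  multiplicative one dilated by \<open>a\<close> and scaled by \<open>c\<close>; in Dirichlet convolutions these dilations
  and scalings multiply, and the Dirichlet convolution of multiplicative functions is
  multiplicative.
\<close>

subsection \<open>The gcd-lcm identity\<close>

text \<open>At each prime the exponents in the gcd and the lcm are the minimum and the maximum of
  the two given exponents, so the local factors only change places. This serves both
  \<open>xi\<close> (with \<open>h p k = fact k\<close>) and multiplicative functions (with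
  \<open>h p k = f (p ^ k)\<close>).\<close>

lemma prod_multiplicity_gcd_lcm:
  fixes h :: "nat \<Rightarrow> nat \<Rightarrow> 'a::comm_monoid_mult"
  assumes h0: "\<And>p. h p 0 = 1"
    and H: "\<And>n. n > 0 \<Longrightarrow> H n = (\<Prod>p\<in>prime_factors n. h p (multiplicity p n))"
    and pos: "m > 0" "n > 0"
  shows "H m * H n = H (gcd m n) * H (lcm m n)"
proof -
  define P where "P = prime_factors m \<union> prime_factors n"
  \<comment> \<open>All four products are taken over the common set \<open>P\<close>; primes absent
    from \<open>k\<close> have exponent 0 and contribute 1 by \<open>h0\<close>.\<close>
  have H_eq: "H k = (\<Prod>p\<in>P. h p (multiplicity p k))"
    if "k > 0" "prime_factors k \<subseteq> P" for k
    unfolding H[OF that(1)]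
  proof (rule prod.mono_neutral_left)
    have "multiplicity p k = 0" if "p \<in> P - prime_factors k" for p
      using that \<open>k > 0\<close> by (auto simp: P_def prime_factors_multiplicity)
    then show "\<forall>p\<in>P - prime_factors k. h p (multiplicity p k) = 1"
      using h0 by simp
  qed (use that in \<open>auto simp: P_def\<close>)
  have lcm_dvd_mult: "lcm m n dvd m * n" by simp
  have sub: "prime_factors (gcd m n) \<subseteq> P" "prime_factors (lcm m n) \<subseteq> P"
    using pos
    by (auto simp: P_def in_prime_factors_iff prime_dvd_mult_iff
        dest: dvd_trans[OF _ lcm_dvd_mult])
  have "h p (multiplicity p m) * h p (multiplicity p n) =
      h p (multiplicity p (gcd m n)) * h p (multiplicity p (lcm m n))" if "p \<in> P" for p
  proof -
    have "prime p" using that by (auto simp: P_def)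
    then show ?thesis
      using pos by (simp add: multiplicity_gcd multiplicity_lcm min_def max_def mult.commute)
  qed
  moreover have "gcd m n > 0" "lcm m n > 0"
    using pos by (auto simp: lcm_pos_nat)
  ultimately show ?thesis
    using pos sub by (simp add: H_eq P_def prod.distrib[symmetric])
qed

lemma multiplicative_prod_prime_powers:
  assumes f: "multiplicative f" and "n > 0"
  shows "f n = (\<Prod>p\<in>prime_factors n. f (p ^ multiplicity p n))"
proof -
  \<comment> \<open>The prime set and the exponents are kept independent of \<open>n\<close>, so
    that the induction can remove a prime without altering the other exponents.\<close>
  have "f (\<Prod>p\<in>S. p ^ e p) = (\<Prod>p\<in>S. f (p ^ e p))"
    if "finite S" "\<forall>p\<in>S. prime p" for S :: "nat set" and e
    using that
  proof (induction S)
    case empty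
    then show ?case using f by (simp add: multiplicative_def)
  next
    case (insert q S)
    have "coprime (q ^ e q) (\<Prod>p\<in>S. p ^ e p)"
      using insert by (intro prod_coprime_right) (auto intro!: primes_coprime)
    moreover have "q ^ e q > 0" "(\<Prod>p\<in>S. p ^ e p) > 0"
      using insert by (auto intro!: prod_pos prime_gt_0_nat)
    ultimately show ?case
      using f insert by (simp add: multiplicative_def)
  qed
  from this[of "prime_factors n" "\<lambda>p. multiplicity p n"] show ?thesis
    using \<open>n > 0\<close> by (simp add: prod_prime_factors in_prime_factors_iff)
qed

lemma multiplicative_gcd_lcm:
  assumes f: "multiplicative f" and "m > 0" "n > 0"
  shows "f m * f n = f (gcd m n) * f (lcm m n)"
proof (rule prod_multiplicity_gcd_lcm[of "\<lambda>p k. f (p ^ k)" f])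
  show "f (p ^ 0) = 1" for p :: nat
    using f by (simp add: multiplicative_def)
qed (use assms in \<open>auto intro: multiplicative_prod_prime_powers\<close>)

text \<open>Converse of the representation by a, c and a multiplicative function. If
  \<open>a\<close> divides both arguments, it factors out of their gcd and lcm; otherwise it misses
  one argument and the gcd, so both sides vanish.\<close>

lemma semimultiplicativeI:
  assumes f: "multiplicative f" and "a > 0" and F0: "F 0 = 0"
    and F: "\<And>n. n > 0 \<Longrightarrow> F n = c * (if a dvd n then f (n div a) else 0)"
  shows "semimultiplicative F"
  unfolding semimultiplicative_def
proof (intro conjI allI impI)
  fix m n :: nat
  assume mn: "m > 0" "n > 0"
  have gl: "gcd m n > 0" "lcm m n > 0"
    using mn by (auto simp: lcm_pos_nat)
  show "F m * F n = F (gcd m n) * F (lcm m n)"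
  proof (cases "a dvd m \<and> a dvd n")
    case True
    then obtain k l where kl: "m = a * k" "n = a * l"
      by (auto elim!: dvdE)
    have "gcd m n = a * gcd k l" "lcm m n = a * lcm k l"
      by (simp_all add: kl gcd_mult_distrib_nat lcm_mult_left)
    moreover have "f k * f l = f (gcd k l) * f (lcm k l)"
      using multiplicative_gcd_lcm[OF f] mn kl by simp
    ultimately show ?thesis
      using mn gl \<open>a > 0\<close> by (simp add: F kl)
  next
    case False
    then have "\<not> a dvd gcd m n" by simp
    with False mn gl show ?thesis by (auto simp: F)
  qed
qed (rule F0)

subsection \<open>The function \<open>xi\<close>\<close>

lemma xi_nonzero [simp]: "xi n \<noteq> 0"
  by (simp add: xi_def)

lemma xi_gcd_lcm:
  assumes "m > 0" "n > 0"
  shows "xi m * xi n = xi (gcd m n) * xi (lcm m n)"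
  by (rule prod_multiplicity_gcd_lcm[of "\<lambda>p k. fact k" xi]) (use assms in \<open>auto simp: xi_def\<close>)

lemma semimultiplicative_divide_xi:
  assumes "semimultiplicative F"
  shows "semimultiplicative (\<lambda>n. F n / xi n)"
  using assms by (simp add: semimultiplicative_def xi_gcd_lcm)

lemma semimultiplicative_times_xi:
  assumes "semimultiplicative F"
  shows "semimultiplicative (\<lambda>n. xi n * F n)"
  unfolding semimultiplicative_def
proof (intro conjI allI impI)
  fix m n :: nat
  assume mn: "m > 0" "n > 0"
  have "xi m * F m * (xi n * F n) = (xi m * xi n) * (F m * F n)" by simp
  also have "\<dots> = (xi (gcd m n) * xi (lcm m n)) * (F (gcd m n) * F (lcm m n))"
    using assms mn xi_gcd_lcm[OF mn] by (simp only: semimultiplicative_def)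
  finally show "xi m * F m * (xi n * F n) = xi (gcd m n) * F (gcd m n) * (xi (lcm m n) * F (lcm m n))"
    by simp
qed (use assms in \<open>simp add: semimultiplicative_def\<close>)

text \<open>Exponents add under multiplication, so each binomial coefficient is a quotient of
  factorials, and these collect to values of \<open>xi\<close>.\<close>

lemma prod_binomial_eq_xi:
  assumes "d > 0" "e > 0"
  shows "of_nat (\<Prod>p\<in>prime_factors (d * e). multiplicity p (d * e) choose multiplicity p d) =
    xi (d * e) / (xi d * xi e)"
proof -
  let ?P = "prime_factors (d * e)"
  \<comment> \<open>Primes of \<open>d * e\<close> that do not divide \<open>k\<close> may be
    included, since they contribute 0! = 1.\<close>
  have xi_eq: "xi k = (\<Prod>p\<in>?P. fact (multiplicity p k))" if "k dvd d * e" for k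
    unfolding xi_def
  proof (rule prod.mono_neutral_left)
    show "prime_factors k \<subseteq> ?P"
      using that assms by (intro dvd_prime_factors) auto
    show "\<forall>p\<in>?P - prime_factors k. fact (multiplicity p k) = 1"
      by (auto simp: prime_factors_multiplicity)
  qed simp
  have "of_nat (multiplicity p (d * e) choose multiplicity p d) =
      (fact (multiplicity p (d * e)) / (fact (multiplicity p d) * fact (multiplicity p e)) :: complex)"
    if "p \<in> ?P" for p
  proof -
    have "multiplicity p (d * e) = multiplicity p d + multiplicity p e"
      using that assms by (intro prime_elem_multiplicity_mult_distrib) auto
    then show ?thesis by (simp add: binomial_fact)
  qed
  then show ?thesis
    by (simp add: xi_eq prod_dividef prod.distrib)
qed

subsection \<open>Dirichlet convolution\<close>

text \<open>Summing over ordered factor pairs instead of divisors keeps the symmetry visible and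
  turns the algebraic laws into reindexings without quotients. At \<open>n = 0\<close> the index set
  is empty, which yields the prescribed value 0.\<close>

definition dirichlet_conv :: "(nat \<Rightarrow> complex) \<Rightarrow> (nat \<Rightarrow> complex) \<Rightarrow> nat \<Rightarrow> complex" where
  "dirichlet_conv f g n = (\<Sum>(d, e) | d * e = n \<and> n > 0. f d * g e)"

lemma finite_factor_pairs [simp]: "finite {(d, e). d * e = n \<and> n > (0::nat)}"
proof (rule finite_subset)
  show "{(d, e). d * e = n \<and> n > 0} \<subseteq> {..n} \<times> {..n}"
    by (auto simp: Suc_le_eq)
qed simp

lemma dirichlet_conv_0 [simp]: "dirichlet_conv f g 0 = 0"
  by (simp add: dirichlet_conv_def)

text \<open>The identity holds also at 0, where both sides vanish, so it can be used as an equation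
  of functions and rewrites nested convolutions too.\<close>

lemma binom_conv_eq:
  "(f \<circ>\<^sub>b g) n = xi n * dirichlet_conv (\<lambda>k. f k / xi k) (\<lambda>k. g k / xi k) n"
proof (cases "n = 0")
  case True
  then show ?thesis by (simp add: binom_conv_def)
next
  case False
  have "(f \<circ>\<^sub>b g) n = (\<Sum>(d, e) | d * e = n \<and> n > 0.
      of_nat (\<Prod>p\<in>prime_factors n. multiplicity p n choose multiplicity p d) * f d * g e)"
    unfolding binom_conv_def using False
    by (auto intro!: sum.reindex_bij_witness[where i = fst and j = "\<lambda>d. (d, n div d)"])
  also have "\<dots> = (\<Sum>(d, e) | d * e = n \<and> n > 0. xi n * (f d / xi d * (g e / xi e)))"
  proof (intro sum.cong refl, clarify)
    fix d e :: nat
    assume "d * e > 0"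
    then show "of_nat (\<Prod>p\<in>prime_factors (d * e). multiplicity p (d * e) choose multiplicity p d)
        * f d * g e = xi (d * e) * (f d / xi d * (g e / xi e))"
      by (subst prod_binomial_eq_xi) auto
  qed
  finally show ?thesis
    by (simp add: dirichlet_conv_def sum_distrib_left case_prod_unfold)
qed

lemma dirichlet_conv_commute: "dirichlet_conv f g = dirichlet_conv g f"
  unfolding dirichlet_conv_def
  by (rule ext, rule sum.reindex_bij_witness[where i = prod.swap and j = prod.swap])
    (auto simp: mult.commute)

lemma dirichlet_conv_assoc:
  "dirichlet_conv (dirichlet_conv f g) h = dirichlet_conv f (dirichlet_conv g h)"
proof
  fix n :: nat
  define D where "D = (\<lambda>n. {(d, e). d * e = n \<and> n > (0::nat)})"
  have fin: "finite (D k)" for k by (simp add: D_def)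
  have "dirichlet_conv (dirichlet_conv f g) h n =
      (\<Sum>x\<in>D n. \<Sum>y\<in>D (fst x). f (fst y) * g (snd y) * h (snd x))"
    by (simp add: dirichlet_conv_def D_def case_prod_unfold sum_distrib_right)
  also have "\<dots> = (\<Sum>(x, y)\<in>(SIGMA x:D n. D (fst x)). f (fst y) * g (snd y) * h (snd x))"
    by (rule sum.Sigma) (auto simp: fin)
  \<comment> \<open>Both index sets encode the ordered factorizations of \<open>n\<close> into three
    factors, bracketed to the left and to the right.\<close>
  also have "\<dots> = (\<Sum>(x, y)\<in>(SIGMA x:D n. D (snd x)). f (fst x) * (g (fst y) * h (snd y)))"
    by (rule sum.reindex_bij_witness[where
          i = "\<lambda>((a, d), (b, c)). ((a * b, c), (a, b))" and
          j = "\<lambda>((d, c), (a, b)). ((a, b * c), (b, c))"])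
      (auto simp: D_def mult_ac)
  also have "\<dots> = (\<Sum>x\<in>D n. \<Sum>y\<in>D (snd x). f (fst x) * (g (fst y) * h (snd y)))"
    by (rule sum.Sigma[symmetric]) (auto simp: fin)
  also have "\<dots> = dirichlet_conv f (dirichlet_conv g h) n"
    by (simp add: dirichlet_conv_def D_def case_prod_unfold sum_distrib_left)
  finally show "dirichlet_conv (dirichlet_conv f g) h n = dirichlet_conv f (dirichlet_conv g h) n" .
qed

lemma dirichlet_conv_unit_left:
  assumes "f 0 = 0"
  shows "dirichlet_conv (\<lambda>n. if n = 1 then 1 else 0) f = f"
proof
  fix n
  show "dirichlet_conv (\<lambda>n. if n = 1 then 1 else 0) f n = f n"
  proof (cases "n = 0")
    case False
    have "dirichlet_conv (\<lambda>n. if n = 1 then 1 else 0) f n =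
        (\<Sum>(d, e)\<in>{(1::nat, n)}. (if d = 1 then 1 else 0) * f e)"
      unfolding dirichlet_conv_def using False
      by (intro sum.mono_neutral_right finite_factor_pairs) (auto split: if_splits)
    then show ?thesis by simp
  qed (use assms in simp)
qed

text \<open>For coprime \<open>m\<close> and \<open>n\<close>, factor pairs of \<open>m * n\<close>
  correspond bijectively to a factor pair of \<open>m\<close> together with one of \<open>n\<close>,
  and the summands factor accordingly.\<close>

lemma multiplicative_dirichlet_conv:
  assumes f: "multiplicative f" and g: "multiplicative g"
  shows "multiplicative (dirichlet_conv f g)"
  unfolding multiplicative_def
proof (intro conjI allI impI)
  have "{(d, e). d * e = (1::nat) \<and> (1::nat) > 0} = {(1, 1)}" by auto
  then show "dirichlet_conv f g 1 = 1"
    using f g by (simp add: dirichlet_conv_def multiplicative_def)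
next
  fix m n :: nat
  assume pos: "m > 0" "n > 0" and mn: "coprime m n"
  define D where "D = (\<lambda>n. {(d, e). d * e = n \<and> n > (0::nat)})"
  have gcds: "gcd (d * d') m = d" "gcd (d * d') n = d'" if "d dvd m" "d' dvd n" for d d'
  proof -
    have "coprime m d'" "coprime n d"
      using coprime_divisors[OF dvd_refl that(2) mn] coprime_divisors[OF that(1) dvd_refl mn]
      by (simp_all add: coprime_commute)
    then show "gcd (d * d') m = d" "gcd (d * d') n = d'"
      using that by (simp_all add: gcd_mult_left_right_cancel gcd_mult_left_left_cancel
          gcd_nat.absorb1)
  qed
  \<comment> \<open>Every divisor of \<open>m * n\<close> is a divisor of \<open>m\<close> times a
    divisor of \<open>n\<close>, and \<open>gcds\<close> recovers the two from their
    product.\<close>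
  have gcd_mult_gcd: "gcd d m * gcd d n = d" if "d dvd m * n" for d
    using division_decomp[OF that] gcds by auto
  \<comment> \<open>The two directions of the bijection: \<open>join\<close> multiplies
    componentwise, \<open>split\<close> cuts the first component by gcds and takes the complementary
    divisors as second components.\<close>
  define join where
    "join = (\<lambda>((d, e), (d', e')). (d * d', e * e' :: nat) :: nat \<times> nat)"
  define split where
    "split = (\<lambda>(d, e :: nat). ((gcd d m, m div gcd d m), (gcd d n, n div gcd d n)))"
  have "dirichlet_conv f g m * dirichlet_conv f g n =
      (\<Sum>x\<in>D m. \<Sum>y\<in>D n. f (fst x) * g (snd x) * (f (fst y) * g (snd y)))"
    by (simp add: dirichlet_conv_def D_def case_prod_unfold sum_product)
  also have "\<dots> = (\<Sum>(x, y)\<in>D m \<times> D n. f (fst x) * g (snd x) * (f (fst y) * g (snd y)))"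
    by (rule sum.cartesian_product)
  also have "\<dots> = (\<Sum>z\<in>D (m * n). f (fst z) * g (snd z))"
  proof (rule sum.reindex_bij_witness[where j = join and i = split])
    fix x assume "x \<in> D m \<times> D n"
    then obtain d e d' e' where x: "x = ((d, e), (d', e'))" and de: "m = d * e" "n = d' * e'"
      by (auto simp: D_def)
    have dvd: "d dvd m" "e dvd m" "d' dvd n" "e' dvd n" using de by auto
    have "m div d = e" "n div d' = e'" using pos de by auto
    then show "split (join x) = x"
      by (simp add: x split_def join_def gcds[OF dvd(1,3)])
    show "join x \<in> D (m * n)"
      using pos by (simp add: x join_def D_def de)
    have "coprime d d'" "coprime e e'"
      using mn dvd by (meson coprime_divisors)+
    moreover have "d > 0" "e > 0" "d' > 0" "e' > 0" using pos de by auto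
    ultimately have "f (d * d') = f d * f d'" "g (e * e') = g e * g e'"
      using f g by (auto simp: multiplicative_def)
    then show "f (fst (join x)) * g (snd (join x)) =
        (case x of (x, y) \<Rightarrow> f (fst x) * g (snd x) * (f (fst y) * g (snd y)))"
      by (simp add: x join_def)
  next
    fix z assume "z \<in> D (m * n)"
    then obtain d e where z: "z = (d, e)" and de: "d * e = m * n"
      by (auto simp: D_def)
    then have d: "gcd d m * gcd d n = d"
      by (intro gcd_mult_gcd) (metis dvd_triv_left)
    have "m div gcd d m * (n div gcd d n) = d * e div d"
      by (simp add: div_mult_div_if_dvd d de)
    also have "d * e div d = e"
    proof -
      have "d > 0" using pos de by (intro Nat.gr0I) auto
      then show ?thesis by simp
    qed
    finally show "join (split z) = z"
      by (simp add: z join_def split_def d)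
    show "split z \<in> D m \<times> D n"
      using pos by (simp add: z split_def D_def)
  qed
  also have "\<dots> = dirichlet_conv f g (m * n)"
    by (simp add: dirichlet_conv_def D_def case_prod_unfold)
  finally show "dirichlet_conv f g (m * n) = dirichlet_conv f g m * dirichlet_conv f g n" ..
qed simp

text \<open>A nonzero summand forces \<open>a dvd d\<close> and \<open>b dvd e\<close>, hence
  \<open>a * b dvd n\<close>; cancelling \<open>a\<close> and \<open>b\<close> then leaves the
  factor pairs of \<open>n div (a * b)\<close>.\<close>

lemma dirichlet_conv_dilate:
  assumes ab: "a > 0" "b > 0" and n: "n > 0"
    and F: "\<And>n. n > 0 \<Longrightarrow> F n = c * (if a dvd n then f (n div a) else 0)"
    and G: "\<And>n. n > 0 \<Longrightarrow> G n = c' * (if b dvd n then g (n div b) else 0)"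
  shows "dirichlet_conv F G n =
    c * c' * (if a * b dvd n then dirichlet_conv f g (n div (a * b)) else 0)"
proof -
  have nz: "a dvd d \<and> b dvd e" if "F d * G e \<noteq> 0" "d * e > 0" for d e
    using that by (auto simp: F G split: if_splits)
  show ?thesis
  proof (cases "a * b dvd n")
    case True
    then obtain k where k: "n = a * b * k" ..
    have "dirichlet_conv F G n =
        (\<Sum>(d, e) | d * e = n \<and> n > 0 \<and> a dvd d \<and> b dvd e. F d * G e)"
      unfolding dirichlet_conv_def
      by (rule sum.mono_neutral_right) (use nz in auto)
    also have "\<dots> = (\<Sum>(d, e) | d * e = k \<and> k > 0. c * c' * (f d * g e))"
      by (rule sum.reindex_bij_witness[where
            i = "\<lambda>(d, e). (a * d, b * e)" and j = "\<lambda>(d, e). (d div a, e div b)"])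
        (use ab n in \<open>auto simp: k F G elim!: dvdE\<close>)
    finally show ?thesis
      using ab True by (simp add: dirichlet_conv_def k sum_distrib_left case_prod_unfold)
  next
    case False
    have "F d * G e = 0" if "d * e = n" for d e
      using nz[of d e] False n that mult_dvd_mono[of a d b e] by auto
    then show ?thesis
      using False by (auto simp: dirichlet_conv_def intro!: sum.neutral)
  qed
qed

subsection \<open>Semimultiplicative functions\<close>

lemma sm_a_nonzero:
  assumes "\<exists>n>0. F n \<noteq> 0"
  shows "sm_a F > 0" "sm_c F \<noteq> 0"
  using LeastI_ex[of "\<lambda>k. k > 0 \<and> F k \<noteq> 0"] assms by (auto simp: sm_a_def sm_c_def)

lemma is_mult_part_mult_part:
  assumes "semimultiplicative F" "\<exists>n>0. F n \<noteq> 0"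
  shows "is_mult_part F (mult_part F)"
  unfolding mult_part_def by (rule theI'[OF is_mult_part_unique[OF assms]])

lemma sm_a_eqI:
  assumes "a > 0" "F a \<noteq> 0" "\<And>n. n > 0 \<Longrightarrow> F n \<noteq> 0 \<Longrightarrow> a dvd n"
  shows "sm_a F = a"
  unfolding sm_a_def by (rule Least_equality) (use assms in \<open>auto intro: dvd_imp_le\<close>)

text \<open>As \<open>xi\<close> never vanishes, dividing by it leaves the support
  unchanged.\<close>

lemma sm_a_divide_xi: "sm_a (\<lambda>n. F n / xi n) = sm_a F"
  by (simp add: sm_a_def)

lemma dirichlet_conv_semimultiplicative:
  assumes "semimultiplicative F" "\<exists>n>0. F n \<noteq> 0"
    and "semimultiplicative G" "\<exists>n>0. G n \<noteq> 0" and "n > 0"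
  shows "dirichlet_conv F G n = sm_c F * sm_c G * (if sm_a F * sm_a G dvd n
    then dirichlet_conv (mult_part F) (mult_part G) (n div (sm_a F * sm_a G)) else 0)"
  by (rule dirichlet_conv_dilate)
    (use assms is_mult_part_mult_part[of F] is_mult_part_mult_part[of G] sm_a_nonzero[of F]
      sm_a_nonzero[of G] in \<open>auto simp: is_mult_part_def\<close>)

lemma multiplicative_dirichlet_conv_mult_part:
  assumes "semimultiplicative F" "\<exists>n>0. F n \<noteq> 0"
    and "semimultiplicative G" "\<exists>n>0. G n \<noteq> 0"
  shows "multiplicative (dirichlet_conv (mult_part F) (mult_part G))"
  by (rule multiplicative_dirichlet_conv)
    (use assms is_mult_part_mult_part in \<open>auto simp: is_mult_part_def\<close>)

lemma semimultiplicative_dirichlet_conv: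
  assumes F: "semimultiplicative F" and G: "semimultiplicative G"
  shows "semimultiplicative (dirichlet_conv F G)"
proof (cases "(\<exists>n>0. F n \<noteq> 0) \<and> (\<exists>n>0. G n \<noteq> 0)")
  case True
  then show ?thesis
    using assms sm_a_nonzero[of F] sm_a_nonzero[of G]
    by (intro semimultiplicativeI[OF multiplicative_dirichlet_conv_mult_part[OF F _ G]
          _ _ dirichlet_conv_semimultiplicative[OF F _ G]]) auto
next
  \<comment> \<open>The multiplicative part exists only for nonzero functions; if a factor is
    identically zero, every summand of the convolution vanishes.\<close>
  case False
  then have "F d * G e = 0" if "d * e > 0" for d e
    using that by (metis mult_eq_0_iff nat_0_less_mult_iff)
  then have "dirichlet_conv F G n = 0" for n
    by (auto simp: dirichlet_conv_def simp del: mult_eq_0_iff intro!: sum.neutral)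
  then show ?thesis by (simp add: semimultiplicative_def)
qed

lemma semimultiplicative_binom_conv:
  assumes "semimultiplicative F" "semimultiplicative G"
  shows "semimultiplicative (F \<circ>\<^sub>b G)"
  unfolding binom_conv_eq[abs_def]
  by (intro semimultiplicative_times_xi semimultiplicative_dirichlet_conv
      semimultiplicative_divide_xi assms)

lemma comm_monoid_semimult_monoid: "comm_monoid semimult_monoid"
proof (rule comm_monoidI)
  let ?e = "\<lambda>n::nat. if n = 1 then 1 else 0 :: complex"
  show "\<one>\<^bsub>semimult_monoid\<^esub> \<in> carrier semimult_monoid"
    by (auto simp: semimult_monoid_def semimultiplicative_def)
  fix F G H
  assume "F \<in> carrier semimult_monoid" "G \<in> carrier semimult_monoid" "H \<in> carrier semimult_monoid"
  then have F: "semimultiplicative F" and G: "semimultiplicative G" and H: "semimultiplicative H"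
    by (simp_all add: semimult_monoid_def)
  show "F \<otimes>\<^bsub>semimult_monoid\<^esub> G \<in> carrier semimult_monoid"
    using semimultiplicative_binom_conv[OF F G] by (simp add: semimult_monoid_def)
  show "F \<otimes>\<^bsub>semimult_monoid\<^esub> G \<otimes>\<^bsub>semimult_monoid\<^esub> H =
      F \<otimes>\<^bsub>semimult_monoid\<^esub> (G \<otimes>\<^bsub>semimult_monoid\<^esub> H)"
    by (simp add: semimult_monoid_def fun_eq_iff binom_conv_eq dirichlet_conv_assoc)
  show "F \<otimes>\<^bsub>semimult_monoid\<^esub> G = G \<otimes>\<^bsub>semimult_monoid\<^esub> F"
    by (simp add: semimult_monoid_def fun_eq_iff binom_conv_eq
        dirichlet_conv_commute[of "\<lambda>k. F k / xi k"])
  \<comment> \<open>Since \<open>xi 1 = 1\<close>, the identity element is fixed by division by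
    \<open>xi\<close> and is also the Dirichlet unit.\<close>
  have "(\<lambda>n. ?e n / xi n) = ?e"
    by (auto simp: xi_def)
  then show "\<one>\<^bsub>semimult_monoid\<^esub> \<otimes>\<^bsub>semimult_monoid\<^esub> F = F"
    using F by (simp add: semimult_monoid_def fun_eq_iff binom_conv_eq dirichlet_conv_unit_left
        semimultiplicative_def del: One_nat_def)
qed

text \<open>The parameters are read off for the Dirichlet convolution of F/xi and G/xi, where they
  simply multiply; the factors \<open>xi\<close> in the formulas record the division by
  \<open>xi\<close> and the multiplication back.\<close>

lemma binom_conv_parameters:
  assumes F: "semimultiplicative F" "\<exists>n>0. F n \<noteq> 0"
    and G: "semimultiplicative G" "\<exists>n>0. G n \<noteq> 0"
  defines "a \<equiv> sm_a F" and "b \<equiv> sm_a G"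
  shows "sm_a (F \<circ>\<^sub>b G) = a * b"
    and "sm_c (F \<circ>\<^sub>b G) = sm_c F * sm_c G * (xi (a * b) / (xi a * xi b))"
    and "mult_part (F \<circ>\<^sub>b G) n = xi_shift (a * b) n / (xi (a * b) * xi n) *
      ((\<lambda>k. xi a * xi k / xi_shift a k * mult_part F k) \<circ>\<^sub>b
       (\<lambda>k. xi b * xi k / xi_shift b k * mult_part G k)) n"
proof -
  define A where "A = (\<lambda>n. F n / xi n)"
  define B where "B = (\<lambda>n. G n / xi n)"
  have A: "semimultiplicative A" "\<exists>n>0. A n \<noteq> 0" and B: "semimultiplicative B" "\<exists>n>0. B n \<noteq> 0"
    using F G by (auto simp: A_def B_def semimultiplicative_divide_xi)
  have aA: "sm_a A = a" and bB: "sm_a B = b"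
    by (simp_all add: A_def B_def a_def b_def sm_a_divide_xi)
  have cA: "sm_c A = sm_c F / xi a" and cB: "sm_c B = sm_c G / xi b"
    by (simp_all add: sm_c_def aA bB flip: a_def b_def) (simp_all add: A_def B_def)
  have pos: "a > 0" "b > 0" and c: "sm_c F \<noteq> 0" "sm_c G \<noteq> 0"
    using F G sm_a_nonzero by (auto simp: a_def b_def)
  let ?h = "dirichlet_conv (mult_part A) (mult_part B)"
  have h1: "?h 1 = 1"
    using multiplicative_dirichlet_conv_mult_part[OF A B] by (simp add: multiplicative_def)
  have conv: "(F \<circ>\<^sub>b G) n = xi n * (sm_c F / xi a * (sm_c G / xi b) *
      (if a * b dvd n then ?h (n div (a * b)) else 0))" if "n > 0" for n
    using dirichlet_conv_semimultiplicative[OF A B that]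
    by (simp add: binom_conv_eq aA bB cA cB flip: A_def B_def)
  \<comment> \<open>At \<open>a * b\<close> the multiplicative factor is \<open>?h 1 = 1\<close>, so
    this value is the constant of the convolution once \<open>a * b\<close> is known to be its least
    support point.\<close>
  have ab: "(F \<circ>\<^sub>b G) (a * b) = sm_c F * sm_c G * (xi (a * b) / (xi a * xi b))"
    using pos h1 by (simp add: conv)
  show sm_a: "sm_a (F \<circ>\<^sub>b G) = a * b"
    by (rule sm_a_eqI) (use pos c ab in \<open>auto simp: conv split: if_splits\<close>)
  show sm_c: "sm_c (F \<circ>\<^sub>b G) = sm_c F * sm_c G * (xi (a * b) / (xi a * xi b))"
    using ab by (simp add: sm_c_def[of "F \<circ>\<^sub>b G"] sm_a)
  have FG: "semimultiplicative (F \<circ>\<^sub>b G)" "\<exists>n>0. (F \<circ>\<^sub>b G) n \<noteq> 0"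
    using F G semimultiplicative_binom_conv ab pos c by (auto intro!: exI[of _ "a * b"])
  \<comment> \<open>This is A(ak)/A(a) with A = F/xi, which explains the weights in the final
    formula.\<close>
  have mA: "mult_part A k = xi a / xi_shift a k * mult_part F k"
    and mB: "mult_part B k = xi b / xi_shift b k * mult_part G k" for k
    using c by (simp_all add: mult_part_eq A B F G aA bB cA cB xi_shift_def flip: a_def b_def)
      (simp_all add: A_def B_def)
  \<comment> \<open>The extra factor \<open>xi k\<close> in each argument cancels the division by
    \<open>xi\<close> in \<open>binom_conv_eq\<close>, leaving exactly the multiplicative parts of
    \<open>A\<close> and \<open>B\<close>.\<close>
  have "((\<lambda>k. xi a * xi k / xi_shift a k * mult_part F k) \<circ>\<^sub>b
       (\<lambda>k. xi b * xi k / xi_shift b k * mult_part G k)) n = xi n * ?h n"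
    by (simp add: binom_conv_eq mA[abs_def] mB[abs_def])
  moreover have "mult_part (F \<circ>\<^sub>b G) n = xi (a * b * n) / xi (a * b) * ?h n"
  proof (cases "n = 0")
    case True
    then show ?thesis
      by (simp add: mult_part_eq[OF FG] binom_conv_def)
  next
    case False
    then show ?thesis
      using pos c by (simp add: mult_part_eq[OF FG] sm_a sm_c conv)
  qed
  ultimately show "mult_part (F \<circ>\<^sub>b G) n = xi_shift (a * b) n / (xi (a * b) * xi n) *
      ((\<lambda>k. xi a * xi k / xi_shift a k * mult_part F k) \<circ>\<^sub>b
       (\<lambda>k. xi b * xi k / xi_shift b k * mult_part G k)) n"
    by (simp add: xi_shift_def)
qed

theorem theorem4p1:
  shows "comm_monoid semimult_monoid \<and>
    (\<forall>F G. semimultiplicative F \<and> (\<exists>n>0. F n \<noteq> 0) \<and>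
           semimultiplicative G \<and> (\<exists>n>0. G n \<noteq> 0) \<longrightarrow>
       sm_a (F \<circ>\<^sub>b G) = sm_a F * sm_a G \<and>
       sm_c (F \<circ>\<^sub>b G) =
         sm_c F * sm_c G * (xi (sm_a F * sm_a G) / (xi (sm_a F) * xi (sm_a G))) \<and>
       mult_part (F \<circ>\<^sub>b G) =
         (\<lambda>n. xi_shift (sm_a F * sm_a G) n / (xi (sm_a F * sm_a G) * xi n) *
            ((\<lambda>k. xi (sm_a F) * xi k / xi_shift (sm_a F) k * mult_part F k) \<circ>\<^sub>b
             (\<lambda>k. xi (sm_a G) * xi k / xi_shift (sm_a G) k * mult_part G k)) n))"
  by (intro conjI allI impI ext comm_monoid_semimult_monoid binom_conv_parameters) auto

end
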